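(* Let $\mathcal{R}$ be a $\ast$-ring and let $a\in\mathcal{R}$. Then the following are equivalent: (i) $a$ is right pseudo core invertible; (ii) $\mathcal{R}a^k=\mathcal{R}(a^k)^{\ast}a^k$ and $a^k\mathcal{R}=a^{k+1}\mathcal{R}$ for some positive integer $k$; (iii) $\mathcal{R}a^k=\mathcal{R}(a^{\ast})^{k+1}a^k$ for some positive integer $k$.
   Context: A $\ast$-ring is an associative ring $\mathcal{R}$ with identity $1$ equipped with an involution, i.e. a map $\ast:\mathcal{R}\to\mathcal{R}$ with $(a^\ast)^\ast=a$, $(a+b)^\ast=a^\ast+b^\ast$, $(ab)^\ast=b^\ast a^\ast$ for all $a,b\in\mathcal{R}$. An element $a\in\mathcal{R}$ is right pseudo core invertible if there exist $x\in\mathcal{R}$ and a positive integer $k$ such that $axa^k=a^k$, $x=ax^2$ and $(ax)^\ast=ax$; any such $x$ is called a right pseudo core inverse of $a$. *)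

theory Defs
  imports Main
begin

(* The base sort is ring + monoid_mult rather than ring_1, because ring_1 would
   require 0 \<noteq> 1 and so exclude the zero ring. *)
class star_ring = ring + monoid_mult +
  fixes star :: "'a \<Rightarrow> 'a"  ("_\<^sup>\<star>" [1000] 999)
  assumes star_star: "(a\<^sup>\<star>)\<^sup>\<star> = a"
    and star_add: "(a + b)\<^sup>\<star> = a\<^sup>\<star> + b\<^sup>\<star>"
    and star_mult: "(a * b)\<^sup>\<star> = b\<^sup>\<star> * a\<^sup>\<star>"

definition right_pseudo_core_inverse :: "'a::star_ring \<Rightarrow> 'a \<Rightarrow> bool" where
  "right_pseudo_core_inverse a x \<longleftrightarrow>
     (\<exists>k::nat. k > 0 \<and> a * x * a ^ k = a ^ k \<and> x = a * x ^ 2 \<and> (a * x)\<^sup>\<star> = a * x)"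

definition right_pseudo_core_invertible :: "'a::star_ring \<Rightarrow> bool" where
  "right_pseudo_core_invertible a \<longleftrightarrow> (\<exists>x. right_pseudo_core_inverse a x)"

definition left_multiples :: "'a::star_ring \<Rightarrow> 'a set" where
  "left_multiples c = {r * c | r. True}"

definition right_multiples :: "'a::star_ring \<Rightarrow> 'a set" where
  "right_multiples c = {c * r | r. True}"

end

theory Submission imports Defs begin

text \<open>
  Write \<open>b = a\<^sup>k\<close>. If \<open>b = r (a\<^sup>\<star>)\<^sup>k a\<^sup>\<star> b\<close>, then
  \<open>s = r a\<^sup>\<star>\<close> satisfies \<open>b = s b\<^sup>\<star> b\<close>, so \<open>s b\<^sup>\<star> = s b\<^sup>\<star> b s\<^sup>\<star>\<close> is
  Hermitian and equals \<open>b s\<^sup>\<star> = a (b r\<^sup>\<star>)\<close>. Hence \<open>x = b r\<^sup>\<star>\<close> is a right pseudo core inverse.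
  Conversely, \<open>x = a x\<^sup>2\<close> gives \<open>a x = a\<^sup>n x\<^sup>n\<close> for all positive \<open>n\<close>, and applying the
  involution to \<open>a x\<close> in \<open>a x a\<^sup>k = a\<^sup>k\<close> gives the left factorisations of \<open>a\<^sup>k\<close>.
\<close>

lemma star_one: "(1::'a::star_ring)\<^sup>\<star> = 1"
  by (metis mult_1 mult_1_right star_mult star_star)

lemma star_power: "((a::'a::star_ring) ^ n)\<^sup>\<star> = a\<^sup>\<star> ^ n"
  by (induction n) (simp_all add: star_one star_mult power_commutes)

text \<open>Left multiples of \<open>c * b\<close> are always left multiples of \<open>b\<close>, so
  equality holds as soon as the generator \<open>b\<close> itself lies in the smaller set. This
  turns equalities of sets into single equations.\<close>

lemma left_multiples_eq_iff:
  "left_multiples b = left_multiples (c * b) \<longleftrightarrow> (\<exists>r. b = r * (c * b))"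
proof
  assume "left_multiples b = left_multiples (c * b)"
  moreover have "b \<in> left_multiples b"
    unfolding left_multiples_def by (auto intro: exI[of _ 1])
  ultimately show "\<exists>r. b = r * (c * b)"
    unfolding left_multiples_def by auto
next
  assume "\<exists>r. b = r * (c * b)"
  then obtain r where r: "b = r * (c * b)" ..
  have "q * b = (q * r) * (c * b)" for q
    by (metis r mult.assoc)
  moreover have "q * (c * b) = (q * c) * b" for q
    by (simp add: mult.assoc)
  ultimately show "left_multiples b = left_multiples (c * b)"
    unfolding left_multiples_def by blast
qed

lemma right_multiples_eq_iff:
  "right_multiples b = right_multiples (b * c) \<longleftrightarrow> (\<exists>r. b = b * c * r)"
proof
  assume "right_multiples b = right_multiples (b * c)"
  moreover have "b \<in> right_multiples b"
    unfolding right_multiples_def by (auto intro: exI[of _ 1])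
  ultimately show "\<exists>r. b = b * c * r"
    unfolding right_multiples_def by auto
next
  assume "\<exists>r. b = b * c * r"
  then obtain r where r: "b = b * c * r" ..
  have "b * q = b * c * (r * q)" for q
    by (metis r mult.assoc)
  moreover have "b * c * q = b * (c * q)" for q
    by (simp add: mult.assoc)
  ultimately show "right_multiples b = right_multiples (b * c)"
    unfolding right_multiples_def by blast
qed

text \<open>The block \<open>a * x ^ 2\<close> in the middle of the product collapses to
  \<open>x\<close>, lowering both exponents by one. The exponent 0 is left out, since it would claim
  \<open>a * x = 1\<close>.\<close>

lemma mult_eq_power_mult_power:
  fixes a x :: "'a::monoid_mult"
  assumes "x = a * x ^ 2"
  shows "a * x = a ^ Suc n * x ^ Suc n"
proof (induction n)
  case (Suc n)
  have "a ^ Suc (Suc n) * x ^ Suc (Suc n) = a ^ Suc n * (a * x ^ 2) * x ^ n"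
    by (simp only: power_Suc2[of a "Suc n"] power_Suc[of x] power2_eq_square mult.assoc)
  also have "\<dots> = a ^ Suc n * x ^ Suc n"
    by (simp add: mult.assoc flip: assms)
  finally show ?case
    using Suc by simp
qed simp

text \<open>One exponent \<open>k\<close> serves all three factorisations, so (ii) and (iii) both
  follow at once.\<close>

lemma right_pseudo_core_invertible_imp:
  fixes a :: "'a::star_ring"
  assumes "right_pseudo_core_invertible a"
  obtains k r s t where "k > 0" "a ^ k = r * (a\<^sup>\<star> ^ (k + 1) * a ^ k)"
    "a ^ k = s * ((a ^ k)\<^sup>\<star> * a ^ k)" "a ^ k = a ^ k * a * t"
proof -
  obtain x k where k: "k > 0" "a * x * a ^ k = a ^ k"
    and x: "x = a * x ^ 2" "(a * x)\<^sup>\<star> = a * x"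
    using assms unfolding right_pseudo_core_invertible_def right_pseudo_core_inverse_def by blast
  have ax: "a * x = a ^ n * x ^ n" if "n > 0" for n
    using mult_eq_power_mult_power[OF x(1), of "n - 1"] unfolding Suc_pred'[OF that, symmetric] .
  \<comment> \<open>Here \<open>a * x\<close>, being Hermitian, is replaced by the star of
    \<open>a ^ n * x ^ n\<close> in \<open>a * x * a ^ k = a ^ k\<close>. Both \<open>n = k\<close>
    and \<open>n = k + 1\<close> are used below.\<close>
  have left: "a ^ k = (x ^ n)\<^sup>\<star> * ((a ^ n)\<^sup>\<star> * a ^ k)" if "n > 0" for n
  proof -
    have "(x ^ n)\<^sup>\<star> * ((a ^ n)\<^sup>\<star> * a ^ k) = (a * x)\<^sup>\<star> * a ^ k"
      by (simp only: ax[OF that] star_mult mult.assoc)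
    then show ?thesis
      by (simp only: x(2) k(2))
  qed
  have right: "a ^ k = a ^ k * a * (x ^ (k + 1) * a ^ k)"
  proof -
    have "a ^ k * a * (x ^ (k + 1) * a ^ k) = a ^ (k + 1) * x ^ (k + 1) * a ^ k"
      by (simp only: Suc_eq_plus1[symmetric] power_Suc2[of a] mult.assoc)
    also have "\<dots> = a ^ k"
      by (simp only: ax[of "k + 1", symmetric] zero_less_one add_pos_pos k)
    finally show ?thesis ..
  qed
  have "a ^ k = (x ^ (k + 1))\<^sup>\<star> * (a\<^sup>\<star> ^ (k + 1) * a ^ k)"
    by (rule left[of "k + 1", unfolded star_power[of a]]) simp
  then show thesis
    using that k(1) left[OF k(1)] right by blast
qed

lemma right_pseudo_core_inverseI:
  fixes a :: "'a::star_ring"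
  assumes "k > 0" and r: "a ^ k = r * (a\<^sup>\<star> ^ (k + 1) * a ^ k)"
  shows "right_pseudo_core_inverse a (a ^ k * r\<^sup>\<star>)"
proof -
  define b where "b = a ^ k"
  define s where "s = r * a\<^sup>\<star>"
  define x where "x = b * r\<^sup>\<star>"
  have b: "b = s * b\<^sup>\<star> * b"
    unfolding s_def b_def star_power
    by (subst r) (simp only: power_Suc Suc_eq_plus1[symmetric] mult.assoc)
  then have "b\<^sup>\<star> = b\<^sup>\<star> * b * s\<^sup>\<star>"
    by (metis star_mult star_star mult.assoc)
  then have "s * b\<^sup>\<star> = s * (b\<^sup>\<star> * b * s\<^sup>\<star>)"
    by (rule arg_cong)
  then have sb: "s * b\<^sup>\<star> = b * s\<^sup>\<star>"
    by (simp only: b[symmetric] mult.assoc[symmetric])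
  \<comment> \<open>Since \<open>a\<close> commutes with its power \<open>b\<close>, it moves past
    \<open>b\<close> and merges with the star of \<open>r\<close> into the star of
    \<open>s\<close>.\<close>
  have ax: "a * x = b * s\<^sup>\<star>"
    by (simp add: x_def s_def b_def star_mult star_star power_commutes flip: mult.assoc)
  have axb: "a * x * b = b"
    by (simp only: ax sb[symmetric] b[symmetric])
  \<comment> \<open>As \<open>x\<close> begins with the factor \<open>b\<close>, multiplying
    \<open>a * x * b = b\<close> on the right by the star of \<open>r\<close> suffices.\<close>
  have "x = a * x ^ 2"
    unfolding power2_eq_square by (metis axb x_def mult.assoc)
  moreover have "(a * x)\<^sup>\<star> = a * x"
    by (metis ax sb star_mult star_star)
  ultimately show ?thesis
    using \<open>k > 0\<close> axb unfolding right_pseudo_core_inverse_def x_def b_def by blast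
qed

theorem theorem4p10:
  fixes a :: "'a::star_ring"
  shows "(right_pseudo_core_invertible a \<longleftrightarrow>
            (\<exists>k::nat. k > 0 \<and>
               left_multiples (a ^ k) = left_multiples ((a ^ k)\<^sup>\<star> * a ^ k) \<and>
               right_multiples (a ^ k) = right_multiples (a ^ (k + 1))))
       \<and> (right_pseudo_core_invertible a \<longleftrightarrow>
            (\<exists>k::nat. k > 0 \<and>
               left_multiples (a ^ k) = left_multiples ((a\<^sup>\<star>) ^ (k + 1) * a ^ k)))"
  (is "(?i \<longleftrightarrow> ?ii) \<and> (?i \<longleftrightarrow> ?iii)")
proof -
  have pow: "a ^ (k + 1) = a ^ k * a" for k
    by (simp add: power_commutes)
  have "?ii \<and> ?iii" if ?i
    using right_pseudo_core_invertible_imp[OF that]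
    unfolding left_multiples_eq_iff pow right_multiples_eq_iff by metis
  moreover have ?iii if ?ii
  proof -
    obtain k where k: "k > 0"
      and "left_multiples (a ^ k) = left_multiples ((a ^ k)\<^sup>\<star> * a ^ k)"
      and "right_multiples (a ^ k) = right_multiples (a ^ (k + 1))"
      using \<open>?ii\<close> by blast
    then have "\<exists>s. a ^ k = s * ((a ^ k)\<^sup>\<star> * a ^ k)" "\<exists>t. a ^ k = a ^ (k + 1) * t"
      unfolding left_multiples_eq_iff pow right_multiples_eq_iff by - assumption+
    then obtain s t where s: "a ^ k = s * ((a ^ k)\<^sup>\<star> * a ^ k)" and t: "a ^ k = a ^ (k + 1) * t"
      by (elim exE)
    \<comment> \<open>Starring the right factorisation yields a left factor of
      \<open>a\<^sup>\<star> ^ (k + 1)\<close>, which is then substituted into \<open>s\<close>'s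
      equation.\<close>
    have "(a ^ k)\<^sup>\<star> = (a ^ (k + 1) * t)\<^sup>\<star>"
      by (rule arg_cong[OF t])
    then have t': "(a ^ k)\<^sup>\<star> = t\<^sup>\<star> * a\<^sup>\<star> ^ (k + 1)"
      by (simp only: star_mult star_power)
    have "a ^ k = (s * t\<^sup>\<star>) * (a\<^sup>\<star> ^ (k + 1) * a ^ k)"
      using s unfolding t' mult.assoc .
    then show ?iii
      unfolding left_multiples_eq_iff using k by blast
  qed
  moreover have ?i if ?iii
    using that right_pseudo_core_inverseI
    unfolding left_multiples_eq_iff right_pseudo_core_invertible_def by blast
  ultimately show ?thesis
    by blast
qed

end
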